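(* Let $K$ be a field of characteristic $2$, $A$ an associative commutative $K$-algebra with unit, and $D$ a nonzero derivation of $A$. Put $\mathcal{L}=\mathsf{S}\otimes A+KD$. Then $$\mathrm{H}^2_+(\mathcal{L},\mathcal{L})\simeq A^D\oplus\frac{A}{D(A)}\oplus\Xi_{D,0}.$$ The basic cocycles can be chosen as follows (the three types realizing the three summands respectively; $a,b$ run over $A$): (i) $(e\otimes a)\wedge(h\otimes b)\mapsto f\otimes abv$ for some $v\in A^D$; (ii) $(e\otimes a)\wedge D\mapsto f\otimes av$ for some $v\in A$; (iii) $(e\otimes a)\wedge(e\otimes b)\mapsto\xi(ab)D$ and $(e\otimes a)\wedge(h\otimes b)\mapsto f\otimes\xi(b)D(a)$, where $\xi\in\Xi_{D,0}$.
   Context: $\mathsf{S}$ is the $3$-dimensional simple Lie algebra over $K$ with basis $\{e,h,f\}$ and multiplication $[e,h]=e$, $[f,h]=f$, $[e,f]=h$. The Lie algebra $\mathsf{S}\otimes A+KD$ has underlying vector space $(\mathsf{S}\otimes A)\oplus KD$ and brackets $[x\otimes a,y\otimes b]=[x,y]\otimes ab$, $[x\otimes a,D]=x\otimes D(a)$. It is $\mathbb{Z}$-graded: weight $-1$: $e\otimes A$; weight $0$: $h\otimes A+KD$; weight $1$: $f\otimes A$. $\mathrm{H}^2(\mathcal{L},\mathcal{L})$ is Chevalley--Eilenberg cohomology (alternating cochains) with adjoint coefficients. A cocycle $\varphi$ has weight $\lambda$ if $\varphi(\mathcal{L}_i,\mathcal{L}_j)\subseteq\mathcal{L}_{i+j+\lambda}$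 for all $i,j$; $\mathrm{H}^2_\lambda$ is spanned by classes of cocycles of weight $\lambda$, and $\mathrm{H}^2_+=\bigoplus_{\lambda>0}\mathrm{H}^2_\lambda$. $A^D=\{a\in A: D(a)=0\}$. $A^{[2]}$ is the linear span of the squares of all elements of $A$. $\Xi_{D,0}$ is the space of linear maps $\xi:A\to K$ vanishing on $A^{[2]}$ and $D(A)$ and satisfying $\xi(a)D(b)+\xi(b)D(a)=0$ and $(\xi(a)b+\xi(b)a+\xi(ab)1)D(c)+(\xi(c)a+\xi(a)c+\xi(ca)1)D(b)+(\xi(b)c+\xi(c)b+\xi(bc)1)D(a)=0$ for all $a,b,c\in A$. When a cocycle is specified by its values on pairs of basic elements, values on all pairs of types not listed are zero. *)

theory Defs
  imports
    Complex_Main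
    "HOL-Library.Set_Algebras"
    "HOL-Library.Function_Algebras"
    "HOL-Library.Product_Plus"
begin

section \<open>Quotients of vector spaces and linear isomorphisms\<close>

text \<open>The elements of $V/W$ are the cosets \<open>v +o W\<close>; they are added with the elementwise sum of
  sets. Adding \<open>W\<close> after scaling makes $0 \cdot X = W$ come out right.\<close>

definition quot :: "'v::plus set \<Rightarrow> 'v set \<Rightarrow> 'v set set"
  where "quot V W = (\<lambda>v. v +o W) ` V"

definition coset_scale :: "('k \<Rightarrow> 'v::plus \<Rightarrow> 'v) \<Rightarrow> 'v set \<Rightarrow> 'k \<Rightarrow> 'v set \<Rightarrow> 'v set"
  where "coset_scale s W c X = s c ` X + W"

definition linear_iso ::
    "('k \<Rightarrow> 'v::plus \<Rightarrow> 'v) \<Rightarrow> 'v set \<Rightarrow> ('k \<Rightarrow> 'w::plus \<Rightarrow> 'w) \<Rightarrow> 'w set \<Rightarrow> ('v \<Rightarrow> 'w) \<Rightarrow> bool"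
  where "linear_iso s V t W F \<longleftrightarrow>
    bij_betw F V W \<and>
    (\<forall>x\<in>V. \<forall>y\<in>V. F (x + y) = F x + F y) \<and>
    (\<forall>c. \<forall>x\<in>V. F (s c x) = t c (F x))"


section \<open>Second Chevalley--Eilenberg cohomology with adjoint coefficients\<close>

text \<open>\<open>s\<close> is the scalar multiplication and \<open>br\<close> the bracket of a Lie algebra on a whole type.\<close>

definition alt_cochains :: "('k::field \<Rightarrow> 'l::ab_group_add \<Rightarrow> 'l) \<Rightarrow> ('l \<Rightarrow> 'l \<Rightarrow> 'l) set"
  where "alt_cochains s = {\<phi>.
    (\<forall>x. Vector_Spaces.linear s s (\<phi> x)) \<and>
    (\<forall>y. Vector_Spaces.linear s s (\<lambda>x. \<phi> x y)) \<and>
    (\<forall>x. \<phi> x x = 0)}"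

definition d1 :: "('l \<Rightarrow> 'l \<Rightarrow> 'l) \<Rightarrow> ('l \<Rightarrow> 'l) \<Rightarrow> 'l \<Rightarrow> 'l \<Rightarrow> 'l::ab_group_add"
  where "d1 br \<omega> = (\<lambda>x y. br x (\<omega> y) - br y (\<omega> x) - \<omega> (br x y))"

definition d2 :: "('l \<Rightarrow> 'l \<Rightarrow> 'l) \<Rightarrow> ('l \<Rightarrow> 'l \<Rightarrow> 'l) \<Rightarrow> 'l \<Rightarrow> 'l \<Rightarrow> 'l \<Rightarrow> 'l::ab_group_add"
  where "d2 br \<phi> = (\<lambda>x y z.
    br x (\<phi> y z) - br y (\<phi> x z) + br z (\<phi> x y)
    - \<phi> (br x y) z + \<phi> (br x z) y - \<phi> (br y z) x)"

definition Z2 :: "('k::field \<Rightarrow> 'l::ab_group_add \<Rightarrow> 'l) \<Rightarrow> ('l \<Rightarrow> 'l \<Rightarrow> 'l) \<Rightarrow> ('l \<Rightarrow> 'l \<Rightarrow> 'l) set"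
  where "Z2 s br = {\<phi> \<in> alt_cochains s. \<forall>x y z. d2 br \<phi> x y z = 0}"

definition B2 :: "('k::field \<Rightarrow> 'l::ab_group_add \<Rightarrow> 'l) \<Rightarrow> ('l \<Rightarrow> 'l \<Rightarrow> 'l) \<Rightarrow> ('l \<Rightarrow> 'l \<Rightarrow> 'l) set"
  where "B2 s br = d1 br ` {\<omega>. Vector_Spaces.linear s s \<omega>}"

definition cochain_scale :: "('k \<Rightarrow> 'l \<Rightarrow> 'l) \<Rightarrow> 'k \<Rightarrow> ('l \<Rightarrow> 'l \<Rightarrow> 'l) \<Rightarrow> 'l \<Rightarrow> 'l \<Rightarrow> 'l"
  where "cochain_scale s c \<phi> = (\<lambda>x y. s c (\<phi> x y))"

definition H2_class ::
    "('k::field \<Rightarrow> 'l::ab_group_add \<Rightarrow> 'l) \<Rightarrow> ('l \<Rightarrow> 'l \<Rightarrow> 'l) \<Rightarrow> ('l \<Rightarrow> 'l \<Rightarrow> 'l) \<Rightarrow> ('l \<Rightarrow> 'l \<Rightarrow> 'l) set"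
  where "H2_class s br \<phi> = \<phi> +o B2 s br"

definition H2 :: "('k::field \<Rightarrow> 'l::ab_group_add \<Rightarrow> 'l) \<Rightarrow> ('l \<Rightarrow> 'l \<Rightarrow> 'l) \<Rightarrow> ('l \<Rightarrow> 'l \<Rightarrow> 'l) set set"
  where "H2 s br = quot (Z2 s br) (B2 s br)"

definition has_weight :: "(int \<Rightarrow> 'l set) \<Rightarrow> int \<Rightarrow> ('l \<Rightarrow> 'l \<Rightarrow> 'l) \<Rightarrow> bool"
  where "has_weight g \<mu> \<phi> \<longleftrightarrow> (\<forall>i j. \<forall>x\<in>g i. \<forall>y\<in>g j. \<phi> x y \<in> g (i + j + \<mu>))"

definition weight_cocycles ::
    "('k::field \<Rightarrow> 'l::ab_group_add \<Rightarrow> 'l) \<Rightarrow> ('l \<Rightarrow> 'l \<Rightarrow> 'l) \<Rightarrow> (int \<Rightarrow> 'l set) \<Rightarrow> int \<Rightarrow>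
      ('l \<Rightarrow> 'l \<Rightarrow> 'l) set"
  where "weight_cocycles s br g \<mu> = {\<phi> \<in> Z2 s br. has_weight g \<mu> \<phi>}"

text \<open>The projection from cocycles to classes is linear, so the span of a set of classes is the
  image of the span of representing cocycles.\<close>

definition H2_weight ::
    "('k::field \<Rightarrow> 'l::ab_group_add \<Rightarrow> 'l) \<Rightarrow> ('l \<Rightarrow> 'l \<Rightarrow> 'l) \<Rightarrow> (int \<Rightarrow> 'l set) \<Rightarrow> int \<Rightarrow>
      ('l \<Rightarrow> 'l \<Rightarrow> 'l) set set"
  where "H2_weight s br g \<mu> =
    H2_class s br ` module.span (cochain_scale s) (weight_cocycles s br g \<mu>)"

text \<open>The sum of the subspaces \<open>H2_weight s br g \<mu>\<close>, \<open>\<mu> > 0\<close>, of the second cohomology; the set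
  \<open>\<Union> (H2_weight s br g \<mu>)\<close> consists of the cocycles whose class lies in \<open>H2_weight s br g \<mu>\<close>.
  That this sum is direct in the case at hand is \<open>H2_plus_direct\<close> below.\<close>

definition H2_plus ::
    "('k::field \<Rightarrow> 'l::ab_group_add \<Rightarrow> 'l) \<Rightarrow> ('l \<Rightarrow> 'l \<Rightarrow> 'l) \<Rightarrow> (int \<Rightarrow> 'l set) \<Rightarrow>
      ('l \<Rightarrow> 'l \<Rightarrow> 'l) set set"
  where "H2_plus s br g =
    H2_class s br ` module.span (cochain_scale s) (\<Union>\<mu>\<in>{0<..}. \<Union> (H2_weight s br g \<mu>))"


section \<open>The Lie algebra $S \otimes A + KD$\<close>

definition comm_algebra :: "('k::field \<Rightarrow> 'a::comm_ring_1 \<Rightarrow> 'a) \<Rightarrow> bool"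
  where "comm_algebra sc \<longleftrightarrow> vector_space sc \<and> (\<forall>k a b. sc k (a * b) = sc k a * b)"

definition derivation :: "('k::field \<Rightarrow> 'a::comm_ring_1 \<Rightarrow> 'a) \<Rightarrow> ('a \<Rightarrow> 'a) \<Rightarrow> bool"
  where "derivation sc D \<longleftrightarrow>
    Vector_Spaces.linear sc sc D \<and> (\<forall>a b. D (a * b) = D a * b + a * D b)"

text \<open>\<open>(x, y, z)\<close> stands for $xe + yh + zf$ in $S$.\<close>

fun S_br :: "'k \<times> 'k \<times> 'k \<Rightarrow> 'k \<times> 'k \<times> 'k \<Rightarrow> 'k \<times> 'k \<times> 'k::field"
  where "S_br (x, y, z) (x', y', z') = (x * y' - y * x', x * z' - z * x', z * y' - y * z')"

text \<open>Since $e, h, f$ is a basis of $S$, the space $(S \otimes A) \oplus KD$ is $A^3 \oplus K$: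
  the tuple \<open>(a, b, c, t)\<close> stands for $e \otimes a + h \otimes b + f \otimes c + tD$.\<close>

type_synonym ('k, 'a) SAD = "'a \<times> 'a \<times> 'a \<times> 'k"

fun SAD_scale :: "('k::field \<Rightarrow> 'a::comm_ring_1 \<Rightarrow> 'a) \<Rightarrow> 'k \<Rightarrow> ('k, 'a) SAD \<Rightarrow> ('k, 'a) SAD"
  where "SAD_scale sc k (a, b, c, t) = (sc k a, sc k b, sc k c, k * t)"

fun SAD_br ::
    "('k::field \<Rightarrow> 'a::comm_ring_1 \<Rightarrow> 'a) \<Rightarrow> ('a \<Rightarrow> 'a) \<Rightarrow> ('k, 'a) SAD \<Rightarrow> ('k, 'a) SAD \<Rightarrow> ('k, 'a) SAD"
  where "SAD_br sc D (a, b, c, t) (a', b', c', t') =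
    (a * b' - b * a' + (sc t' (D a) - sc t (D a')),
     a * c' - c * a' + (sc t' (D b) - sc t (D b')),
     c * b' - b * c' + (sc t' (D c) - sc t (D c')),
     0)"

fun tens :: "('k \<Rightarrow> 'a \<Rightarrow> 'a) \<Rightarrow> 'k \<times> 'k \<times> 'k \<Rightarrow> 'a \<Rightarrow> ('k::field, 'a::comm_ring_1) SAD"
  where "tens sc (x, y, z) a = (sc x a, sc y a, sc z a, 0)"

abbreviation eA :: "'a \<Rightarrow> ('k::field, 'a::comm_ring_1) SAD" where "eA a \<equiv> (a, 0, 0, 0)"
abbreviation hA :: "'a \<Rightarrow> ('k::field, 'a::comm_ring_1) SAD" where "hA a \<equiv> (0, a, 0, 0)"
abbreviation fA :: "'a \<Rightarrow> ('k::field, 'a::comm_ring_1) SAD" where "fA a \<equiv> (0, 0, a, 0)"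
abbreviation DK :: "'k \<Rightarrow> ('k::field, 'a::comm_ring_1) SAD" where "DK t \<equiv> (0, 0, 0, t)"

definition SAD_grading :: "int \<Rightarrow> ('k::field, 'a::comm_ring_1) SAD set"
  where "SAD_grading i =
    (if i = -1 then range eA
     else if i = 0 then {hA b + DK t | b t. True}
     else if i = 1 then range fA
     else {0})"


section \<open>The data of the statement\<close>

definition constants :: "('a \<Rightarrow> 'a::comm_ring_1) \<Rightarrow> 'a set"
  where "constants D = {a. D a = 0}"

definition squares_span :: "('k::field \<Rightarrow> 'a::comm_ring_1 \<Rightarrow> 'a) \<Rightarrow> 'a set"
  where "squares_span sc = module.span sc (range (\<lambda>a. a ^ 2))"

definition Xi :: "('k::field \<Rightarrow> 'a::comm_ring_1 \<Rightarrow> 'a) \<Rightarrow> ('a \<Rightarrow> 'a) \<Rightarrow> ('a \<Rightarrow> 'k) set"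
  where "Xi sc D = {\<xi>.
    Vector_Spaces.linear sc (*) \<xi> \<and>
    (\<forall>a\<in>squares_span sc. \<xi> a = 0) \<and>
    (\<forall>a\<in>range D. \<xi> a = 0) \<and>
    (\<forall>a b. sc (\<xi> a) (D b) + sc (\<xi> b) (D a) = 0) \<and>
    (\<forall>a b c.
      (sc (\<xi> a) b + sc (\<xi> b) a + sc (\<xi> (a * b)) 1) * D c +
      (sc (\<xi> c) a + sc (\<xi> a) c + sc (\<xi> (c * a)) 1) * D b +
      (sc (\<xi> b) c + sc (\<xi> c) b + sc (\<xi> (b * c)) 1) * D a = 0)}"

fun summand_scale ::
    "('k::field \<Rightarrow> 'a::comm_ring_1 \<Rightarrow> 'a) \<Rightarrow> ('a \<Rightarrow> 'a) \<Rightarrow>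
      'k \<Rightarrow> 'a \<times> 'a set \<times> ('a \<Rightarrow> 'k) \<Rightarrow> 'a \<times> 'a set \<times> ('a \<Rightarrow> 'k)"
  where "summand_scale sc D k (v, X, \<xi>) =
    (sc k v, coset_scale sc (range D) k X, (\<lambda>a. k * \<xi> a))"

text \<open>Each basic cocycle is the alternating bilinear extension of its listed values; see the three
  lemmas \<open>cocycle_*_values\<close>.\<close>

fun cocycle_i :: "'a \<Rightarrow> ('k::field, 'a::comm_ring_1) SAD \<Rightarrow> ('k, 'a) SAD \<Rightarrow> ('k, 'a) SAD"
  where "cocycle_i v (a, b, c, t) (a', b', c', t') = fA (a * b' * v - a' * b * v)"

fun cocycle_ii ::
    "('k::field \<Rightarrow> 'a::comm_ring_1 \<Rightarrow> 'a) \<Rightarrow> 'a \<Rightarrow> ('k, 'a) SAD \<Rightarrow> ('k, 'a) SAD \<Rightarrow> ('k, 'a) SAD"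
  where "cocycle_ii sc v (a, b, c, t) (a', b', c', t') = fA (sc t' (a * v) - sc t (a' * v))"

fun cocycle_iii ::
    "('k::field \<Rightarrow> 'a::comm_ring_1 \<Rightarrow> 'a) \<Rightarrow> ('a \<Rightarrow> 'a) \<Rightarrow> ('a \<Rightarrow> 'k) \<Rightarrow>
      ('k, 'a) SAD \<Rightarrow> ('k, 'a) SAD \<Rightarrow> ('k, 'a) SAD"
  where "cocycle_iii sc D \<xi> (a, b, c, t) (a', b', c', t') =
    DK (\<xi> (a * a')) + fA (sc (\<xi> b') (D a) - sc (\<xi> b) (D a'))"


section \<open>Consistency of the definitions\<close>

locale derivation_algebra =
  fixes sc :: "'k::field \<Rightarrow> 'a::comm_ring_1 \<Rightarrow> 'a" and D :: "'a \<Rightarrow> 'a"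
  assumes alg: "comm_algebra sc" and der: "derivation sc D"
begin

sublocale vector_space sc
  using alg by (simp add: comm_algebra_def)

sublocale D: Vector_Spaces.linear sc sc D
  using der by (simp add: derivation_def)

lemma D_mult: "D (a * b) = D a * b + a * D b"
  using der by (simp add: derivation_def)

lemma mult_sc: "sc k a * b = sc k (a * b)" "a * sc k b = sc k (a * b)"
  using alg by (simp_all add: comm_algebra_def) (metis mult.commute)

lemmas D_simps = D.add D.diff D.neg D.scale D_mult

lemma vector_space_SAD: "vector_space (SAD_scale sc)"
  by unfold_locales (auto simp: algebra_simps zero_prod_def)

lemma SAD_br_tens: "SAD_br sc D (tens sc x a) (tens sc y b) = tens sc (S_br x y) (a * b)"
  by (cases x; cases y)
    (simp add: mult_sc algebra_simps)

lemma SAD_br_tens_D: "SAD_br sc D (tens sc x a) (DK 1) = tens sc x (D a)"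
  by (cases x) (simp add: D_simps)

lemma SAD_br_alt: "SAD_br sc D x x = 0"
  by (cases x) (simp add: zero_prod_def algebra_simps)

lemma SAD_br_linear:
  "SAD_br sc D (x + y) z = SAD_br sc D x z + SAD_br sc D y z"
  "SAD_br sc D x (y + z) = SAD_br sc D x y + SAD_br sc D x z"
  "SAD_br sc D (SAD_scale sc k x) y = SAD_scale sc k (SAD_br sc D x y)"
  "SAD_br sc D x (SAD_scale sc k y) = SAD_scale sc k (SAD_br sc D x y)"
  by (cases x; cases y; cases z;
      simp add: D_simps mult_sc algebra_simps)+

lemma SAD_br_jacobi:
  assumes "CHAR('k) = 2"
  shows "SAD_br sc D x (SAD_br sc D y z) + SAD_br sc D y (SAD_br sc D z x)
    + SAD_br sc D z (SAD_br sc D x y) = 0"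
proof -
  have "(2::'k) = 0"
    using of_nat_CHAR[where 'a='k] assms by simp
  then have "sc 2 a = 0" for a by simp
  then have two: "a + a = 0" for a :: 'a
    by (metis one_add_one scale_left_distrib scale_one)
  then have neg: "- a = a" for a :: 'a
    by (metis add_eq_0_iff)
  have diff: "a - b = a + b" for a b :: 'a
    using neg by (metis diff_conv_add_uminus)
  have cancel: "a + (a + b) = b" for a b :: 'a
    using two by (metis add.assoc add_0)
  show ?thesis
    by (cases x; cases y; cases z)
      (simp add: zero_prod_def D.add D.scale D_mult mult_sc diff two cancel ring_distribs
        scale_right_distrib ac_simps)
qed

lemma cocycle_i_values:
  "cocycle_i v (eA a) (hA b) = fA (a * b * v)"
  "cocycle_i v (eA a) (eA b) = 0" "cocycle_i v (eA a) (fA b) = 0"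
  "cocycle_i v (eA a) (DK t) = 0" "cocycle_i v (hA a) (hA b) = 0"
  "cocycle_i v (hA a) (fA b) = 0" "cocycle_i v (hA a) (DK t) = 0"
  "cocycle_i v (fA a) (fA b) = 0" "cocycle_i v (fA a) (DK t) = 0"
  by (simp_all add: zero_prod_def)

lemma cocycle_ii_values:
  "cocycle_ii sc v (eA a) (DK 1) = fA (a * v)"
  "cocycle_ii sc v (eA a) (eA b) = 0" "cocycle_ii sc v (eA a) (hA b) = 0"
  "cocycle_ii sc v (eA a) (fA b) = 0" "cocycle_ii sc v (hA a) (hA b) = 0"
  "cocycle_ii sc v (hA a) (fA b) = 0" "cocycle_ii sc v (hA a) (DK 1) = 0"
  "cocycle_ii sc v (fA a) (fA b) = 0" "cocycle_ii sc v (fA a) (DK 1) = 0"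
  by (simp_all add: zero_prod_def)

lemma cocycle_iii_values:
  assumes "\<xi> \<in> Xi sc D"
  shows
  "cocycle_iii sc D \<xi> (eA a) (eA b) = DK (\<xi> (a * b))"
  "cocycle_iii sc D \<xi> (eA a) (hA b) = fA (sc (\<xi> b) (D a))"
  "cocycle_iii sc D \<xi> (eA a) (fA b) = 0" "cocycle_iii sc D \<xi> (eA a) (DK 1) = 0"
  "cocycle_iii sc D \<xi> (hA a) (hA b) = 0" "cocycle_iii sc D \<xi> (hA a) (fA b) = 0"
  "cocycle_iii sc D \<xi> (hA a) (DK 1) = 0" "cocycle_iii sc D \<xi> (fA a) (fA b) = 0"
  "cocycle_iii sc D \<xi> (fA a) (DK 1) = 0"
proof -
  have "Vector_Spaces.linear sc (*) \<xi>" using assms by (simp add: Xi_def)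
  then interpret xi: Vector_Spaces.linear sc "(*)" \<xi> .
  have "\<xi> 0 = 0" by (rule xi.zero)
  then show
  "cocycle_iii sc D \<xi> (eA a) (eA b) = DK (\<xi> (a * b))"
  "cocycle_iii sc D \<xi> (eA a) (hA b) = fA (sc (\<xi> b) (D a))"
  "cocycle_iii sc D \<xi> (eA a) (fA b) = 0" "cocycle_iii sc D \<xi> (eA a) (DK 1) = 0"
  "cocycle_iii sc D \<xi> (hA a) (hA b) = 0" "cocycle_iii sc D \<xi> (hA a) (fA b) = 0"
  "cocycle_iii sc D \<xi> (hA a) (DK 1) = 0" "cocycle_iii sc D \<xi> (fA a) (fA b) = 0"
  "cocycle_iii sc D \<xi> (fA a) (DK 1) = 0"
    by (simp_all add: zero_prod_def D_simps)
qed

text \<open>The sum defining \<open>H2_plus\<close> is direct: if a sum of classes of cocycles of distinct weights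
  vanishes, then each of the classes vanishes. The weight \<open>\<mu>\<close> part of a cochain bounding the sum
  bounds the summand of weight \<open>\<mu>\<close>.\<close>

theorem H2_plus_direct:
  fixes \<phi> :: "int \<Rightarrow> ('k, 'a) SAD \<Rightarrow> ('k, 'a) SAD \<Rightarrow> ('k, 'a) SAD"
  assumes fin: "finite \<Lambda>"
    and wt: "\<And>\<mu>. \<mu> \<in> \<Lambda> \<Longrightarrow> \<phi> \<mu> \<in> weight_cocycles (SAD_scale sc) (SAD_br sc D) SAD_grading \<mu>"
    and B: "(\<Sum>\<mu>\<in>\<Lambda>. \<phi> \<mu>) \<in> B2 (SAD_scale sc) (SAD_br sc D)"
    and l: "l \<in> \<Lambda>"
  shows "\<phi> l \<in> B2 (SAD_scale sc) (SAD_br sc D)"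
proof -
  let ?s = "SAD_scale sc" and ?b = "SAD_br sc D" and ?g = "SAD_grading :: int \<Rightarrow> ('k, 'a) SAD set"
  interpret L: vector_space ?s by (rule vector_space_SAD)
  interpret LL: vector_space_pair ?s ?s ..
  define P :: "int \<Rightarrow> ('k, 'a) SAD \<Rightarrow> ('k, 'a) SAD" where
    "P i = (\<lambda>(a, b, c, t). if i = -1 then eA a else if i = 0 then (0, b, 0, t)
      else if i = 1 then fA c else 0)" for i
  have P_lin: "Vector_Spaces.linear ?s ?s (P i)" for i
    by unfold_locales (auto simp: P_def zero_prod_def)
  have P_in: "P i x \<in> ?g i" for i x
    by (cases x) (auto simp: P_def SAD_grading_def)
  have P_out: "P j x = (if i = j then x else 0)" if "x \<in> ?g i" for i j x
    using that by (auto simp: P_def SAD_grading_def zero_prod_def split: if_splits)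
  have P_sum: "x = P (-1) x + P 0 x + P 1 x" for x
    by (cases x) (simp add: P_def)
  have P_br: "?b x (P k z) = P (i + k) (?b x z)" if "x \<in> ?g i" for i k x z
    using that
    by (cases z; cases "k = -2"; cases "k = -1"; cases "k = 0"; cases "k = 1"; cases "k = 2")
      (auto simp: P_def SAD_grading_def zero_prod_def D_simps split: if_splits)
  have br_in: "?b x y \<in> ?g (i + j)" if "x \<in> ?g i" "y \<in> ?g j" for i j x y
  proof -
    have "P j y = y" using P_out[OF that(2), of j] by simp
    then have "?b x y = P (i + j) (?b x y)" using P_br[OF that(1), of j y] by simp
    then show ?thesis using P_in by metis
  qed
  obtain \<omega> where om: "Vector_Spaces.linear ?s ?s \<omega>" and eq: "(\<Sum>\<mu>\<in>\<Lambda>. \<phi> \<mu>) = d1 ?b \<omega>"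
    using B by (auto simp: B2_def)
  have sum_app: "(\<Sum>\<mu>\<in>\<Lambda>. \<phi> \<mu>) x y = (\<Sum>\<mu>\<in>\<Lambda>. \<phi> \<mu> x y)" for x y
    using fin by (induction rule: finite_induct) auto
  define \<eta> where "\<eta> x = P (-1 + l) (\<omega> (P (-1) x)) + P l (\<omega> (P 0 x)) + P (1 + l) (\<omega> (P 1 x))" for x
  have "Vector_Spaces.linear ?s ?s (\<lambda>x. P k (\<omega> (P i x)))" for i k
    using Vector_Spaces.linear_compose[OF Vector_Spaces.linear_compose[OF P_lin om] P_lin]
    by (simp add: comp_def)
  then have eta_lin: "Vector_Spaces.linear ?s ?s \<eta>"
    unfolding \<eta>_def by (intro LL.linear_compose_add)
  have eta_g: "\<eta> x = P (i + l) (\<omega> x)" if "x \<in> ?g i" for i x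
  proof -
    have z: "\<omega> 0 = 0" "P k 0 = 0" for k
      using om P_lin LL.linear_0 by blast+
    have "x = 0" if "i \<noteq> -1" "i \<noteq> 0" "i \<noteq> 1"
      using \<open>x \<in> ?g i\<close> that by (simp add: SAD_grading_def)
    then show ?thesis
      unfolding \<eta>_def P_out[OF that] by (auto simp: z)
  qed
  have phi: "\<phi> l \<in> alt_cochains ?s"
    using wt[OF l] by (simp add: weight_cocycles_def Z2_def)
  have br_add: "?b (x + y) z = ?b x z + ?b y z" "?b z (x + y) = ?b z x + ?b z y" for x y z
    by (rule SAD_br_linear)+
  have hom: "\<phi> l x y = d1 ?b \<eta> x y" if x: "x \<in> ?g i" and y: "y \<in> ?g j" for i j x y
  proof -
    have Pd: "P k (u - v) = P k u - P k v" for k u v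
      using P_lin LL.linear_diff by blast
    have "P (i + j + l) (\<phi> m x y) = (if m = l then \<phi> l x y else 0)" if "m \<in> \<Lambda>" for m
    proof -
      have "\<phi> m x y \<in> ?g (i + j + m)"
        using wt[OF that] x y by (simp add: weight_cocycles_def has_weight_def)
      from P_out[OF this, of "i + j + l"] show ?thesis by auto
    qed
    then have "P (i + j + l) (\<Sum>m\<in>\<Lambda>. \<phi> m x y) = (\<Sum>m\<in>\<Lambda>. if m = l then \<phi> l x y else 0)"
      unfolding LL.linear_sum[OF P_lin] by (intro sum.cong) auto
    also have "\<dots> = \<phi> l x y" using fin l by simp
    finally have "\<phi> l x y = P (i + j + l) (d1 ?b \<omega> x y)"
      using eq sum_app by metis
    also have "\<dots> = P (i + (j + l)) (?b x (\<omega> y)) - P (j + (i + l)) (?b y (\<omega> x))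
        - P (i + j + l) (\<omega> (?b x y))"
      unfolding d1_def Pd by (simp add: ac_simps)
    also have "\<dots> = d1 ?b \<eta> x y"
      unfolding d1_def eta_g[OF x] eta_g[OF y] eta_g[OF br_in[OF x y]]
      by (simp add: P_br[OF x] P_br[OF y])
    finally show ?thesis .
  qed
  have phi_add: "\<phi> l (x + y) z = \<phi> l x z + \<phi> l y z" "\<phi> l z (x + y) = \<phi> l z x + \<phi> l z y" for x y z
  proof -
    have lin: "Vector_Spaces.linear ?s ?s (\<phi> l z)" "Vector_Spaces.linear ?s ?s (\<lambda>x. \<phi> l x z)"
      using phi unfolding alt_cochains_def by blast+
    show "\<phi> l (x + y) z = \<phi> l x z + \<phi> l y z" "\<phi> l z (x + y) = \<phi> l z x + \<phi> l z y"
      using LL.linear_add[OF lin(2)] LL.linear_add[OF lin(1)] by blast+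
  qed
  have d_add: "d1 ?b \<eta> (x + y) z = d1 ?b \<eta> x z + d1 ?b \<eta> y z"
    "d1 ?b \<eta> z (x + y) = d1 ?b \<eta> z x + d1 ?b \<eta> z y" for x y z
    unfolding d1_def br_add LL.linear_add[OF eta_lin] by (simp_all add: algebra_simps)
  have "\<phi> l x y = d1 ?b \<eta> x y" for x y
  proof -
    have "\<phi> l (P (-1) x + P 0 x + P 1 x) (P (-1) y + P 0 y + P 1 y) =
        d1 ?b \<eta> (P (-1) x + P 0 x + P 1 x) (P (-1) y + P 0 y + P 1 y)"
      by (simp only: phi_add d_add hom[OF P_in P_in])
    then show ?thesis by (simp only: P_sum[symmetric])
  qed
  then have "\<phi> l = d1 ?b \<eta>" by blast
  then show ?thesis using eta_lin by (auto simp: B2_def)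
qed

end

end

theory Submission
  imports Defs
begin

text \<open>
  In characteristic two, \<open>ad (h \<otimes> 1)\<close> acts on the component of degree \<open>i\<close> as multiplication by \<open>i\<close>:
  it is the projection onto the two odd components. Contraction with \<open>h \<otimes> 1\<close> is therefore a
  homotopy that bounds every cocycle of odd weight (\<open>odd_weight_coboundary\<close>). As the degrees lie
  between $-1$ and $1$, cochains of weight at least four vanish (\<open>large_weight_zero\<close>), so that
  everything happens in weight two.

  A cochain \<open>\<phi>\<close> of weight two consists of four maps:
  \[ \varphi(e\otimes a, e\otimes b) = h\otimes G(a,b) + g(a,b) D, \quad
     \varphi(e\otimes a, h\otimes b) = f\otimes P(a,b), \quad
     \varphi(e\otimes a, D) = f\otimes p(a). \]
  The cocycle equations on the triples of basic elements of total degree $-2$ and $-1$, taken with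
  some of the arguments equal to $1$, can be solved outright. With $u = P(1,1)$, $q = p(1)$,
  $\xi(a) = g(a,1)$ and $w(a) = P(1,a) + au$ they give
  \[ g(a,b) = \xi(ab), \quad G(a,b) = a w(b) + b w(a), \quad
     P(a,b) = b w(a) + w(ab) + abu + \xi(a) D(b), \quad
     p(a) = aq + D(w(a)) + w(D(a)), \]
  together with $D(u) = 0$ and the conditions for $\xi \in \Xi_{D,0}$. The terms with $w$ are the
  coboundary of $e\otimes a \mapsto f\otimes w(a)$; the others are the basic cocycles of the three
  types for $u$, $q$ and $\xi$ (\<open>weight_two_decomposition\<close>).

  Conversely, when a sum of basic cocycles is a coboundary, evaluation at $(e\otimes a, e\otimes 1)$,
  $(e\otimes 1, h\otimes 1)$ and $(e\otimes 1, D)$ yields $\xi = 0$, $u = 0$ and $q \in D(A)$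
  (\<open>basic_coboundaryD\<close>), while the cocycle of the second type for $D(z)$ bounds
  (\<open>cocycle_ii_coboundary\<close>). Hence \<open>class_map\<close> is well defined and bijective.
\<close>

section \<open>Cosets of a subspace\<close>

context module
begin

lemma coset_eq_iff:
  assumes "subspace W"
  shows "v +o W = v' +o W \<longleftrightarrow> v - v' \<in> W"
proof
  assume "v +o W = v' +o W"
  moreover have "v \<in> v +o W"
    using subspace_0[OF assms] by (force simp: elt_set_plus_def)
  ultimately obtain w where "w \<in> W" "v = v' + w"
    by (auto simp: elt_set_plus_def)
  then show "v - v' \<in> W" by simp
next
  assume d: "v - v' \<in> W"
  have "v + w = v' + ((v - v') + w)" "v' + w = v + (w - (v - v'))" for w
    by (simp_all add: algebra_simps)
  then show "v +o W = v' +o W"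
    using subspace_add[OF assms d] subspace_diff[OF assms _ d]
    unfolding elt_set_plus_def by blast
qed

lemma subspace_plus_self: "subspace W \<Longrightarrow> W + W = W"
  using subspace_add[of W] subspace_0[of W] by (force simp: set_plus_def)

lemma coset_add:
  assumes "subspace W"
  shows "(v +o W) + (v' +o W) = (v + v') +o W"
  by (simp add: set_plus_rearrange subspace_plus_self[OF assms])

lemma coset_scale_coset:
  assumes "subspace W"
  shows "coset_scale scale W c (v +o W) = scale c v +o W"
proof -
  have "scale c ` (v +o W) + W = {scale c v + (scale c w + w') | w w'. w \<in> W \<and> w' \<in> W}"
    by (auto simp: set_plus_def elt_set_plus_def scale_right_distrib add.assoc) blast+
  also have "\<dots> = scale c v +o W"
  proof
    show "scale c v +o W \<subseteq> {scale c v + (scale c w + w') | w w'. w \<in> W \<and> w' \<in> W}"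
      using subspace_0[OF assms] by (force simp: elt_set_plus_def)
  qed (auto simp: elt_set_plus_def intro!: subspace_add[OF assms] subspace_scale[OF assms])
  finally show ?thesis by (simp add: coset_scale_def)
qed

end


section \<open>Cochains in characteristic two\<close>

locale derivation_algebra_char2 = derivation_algebra sc D
  for sc :: "'k::field \<Rightarrow> 'a::comm_ring_1 \<Rightarrow> 'a" and D :: "'a \<Rightarrow> 'a" +
  assumes char2: "CHAR('k) = 2"
begin

abbreviation "sL \<equiv> SAD_scale sc"
abbreviation "brL \<equiv> SAD_br sc D"
abbreviation "B2L \<equiv> B2 sL brL"
abbreviation "grL \<equiv> (SAD_grading :: int \<Rightarrow> ('k, 'a) SAD set)"

lemma double_k: "t + t = 0" for t :: 'k
proof -
  have "(2::'k) = 0" using of_nat_CHAR[where 'a='k] char2 by simp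
  then show ?thesis by (metis mult_2 mult_zero_left)
qed

lemma double: "a + a = 0" for a :: 'a
  by (metis double_k scale_left_distrib scale_one scale_zero_left)

lemma neg: "- a = a" for a :: 'a
  by (metis double add_eq_0_iff)

lemma diff: "a - b = a + b" for a b :: 'a
  by (metis neg diff_conv_add_uminus)

lemma cancel: "a + (a + b) = b" for a b :: 'a
  by (metis double add.assoc add_0)

lemma neg_k: "- t = t" for t :: 'k
  by (metis double_k add_eq_0_iff)

lemma diff_k: "t - u = t + u" for t u :: 'k
  by (metis neg_k diff_conv_add_uminus)

lemma cancel_k: "t + (t + u) = u" for t u :: 'k
  by (metis double_k add.assoc add_0)

lemmas char2_simps = double neg diff cancel double_k neg_k diff_k cancel_k

lemma eq_iff_sum_zero: "a = b \<longleftrightarrow> a + b = 0" for a b :: 'a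
  by (metis diff eq_iff_diff_eq_0)

lemma neg_L: "- x = x" for x :: "('k, 'a) SAD"
  by (cases x) (simp add: char2_simps)

lemma diff_L: "x - y = x + y" for x y :: "('k, 'a) SAD"
  by (metis neg_L diff_conv_add_uminus)

lemma double_L: "x + x = 0" for x :: "('k, 'a) SAD"
  by (cases x) (simp add: char2_simps zero_prod_def)

lemma cancel_L: "x + (x + y) = y" for x y :: "('k, 'a) SAD"
  by (metis double_L add.assoc add_0)

lemma D_one: "D 1 = 0"
  using D_mult[of 1 1] by simp

sublocale L: vector_space sL
  by (rule vector_space_SAD)

sublocale LL: vector_space_pair sL sL ..

lemma vector_space_cochains: "vector_space (cochain_scale sL)"
  by unfold_locales
    (auto simp: cochain_scale_def fun_eq_iff L.scale_right_distrib L.scale_left_distrib)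

sublocale C: vector_space "cochain_scale sL"
  by (rule vector_space_cochains)

lemma brL_add: "brL (x + y) z = brL x z + brL y z" "brL z (x + y) = brL z x + brL z y"
  by (rule SAD_br_linear)+

lemma alt_cochainD:
  assumes "\<phi> \<in> alt_cochains sL"
  shows "\<phi> (x + y) z = \<phi> x z + \<phi> y z" "\<phi> z (x + y) = \<phi> z x + \<phi> z y"
    "\<phi> (sL c x) y = sL c (\<phi> x y)" "\<phi> y (sL c x) = sL c (\<phi> y x)"
    "\<phi> 0 x = 0" "\<phi> x 0 = 0" "\<phi> x x = 0" "\<phi> x y = \<phi> y x"
proof -
  have lin: "Vector_Spaces.linear sL sL (\<phi> z)" "Vector_Spaces.linear sL sL (\<lambda>x. \<phi> x z)" for z
    using assms unfolding alt_cochains_def by blast+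
  have add1: "\<phi> (x + y) z = \<phi> x z + \<phi> y z" for x y z using LL.linear_add[OF lin(2)] by blast
  have add2: "\<phi> z (x + y) = \<phi> z x + \<phi> z y" for x y z using LL.linear_add[OF lin(1)] by blast
  have alt: "\<phi> x x = 0" for x using assms unfolding alt_cochains_def by blast
  show "\<phi> (x + y) z = \<phi> x z + \<phi> y z" by (rule add1)
  show "\<phi> z (x + y) = \<phi> z x + \<phi> z y" by (rule add2)
  show "\<phi> (sL c x) y = sL c (\<phi> x y)" using LL.linear_scale[OF lin(2)] by blast
  show "\<phi> y (sL c x) = sL c (\<phi> y x)" using LL.linear_scale[OF lin(1)] by blast
  show "\<phi> 0 x = 0" using LL.linear_0[OF lin(2)] by blast
  show "\<phi> x 0 = 0" using LL.linear_0[OF lin(1)] by blast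
  show "\<phi> x x = 0" by (rule alt)
  have "\<phi> (x + y) (x + y) = \<phi> x y + \<phi> y x"
    unfolding add1 add2 by (simp add: alt)
  then have "\<phi> x y + \<phi> y x = 0" by (simp add: alt)
  then show "\<phi> x y = \<phi> y x" by (metis diff_L eq_iff_diff_eq_0)
qed

text \<open>Rewriting with these rules brings an expression in the bracket and the derivation into the
  form of a sum of distinct monomials: over a field of characteristic two signs disappear, and
  the rules \<open>cancel\<close> remove repeated summands once associativity and commutativity have made them
  adjacent.\<close>

lemmas normalize = char2_simps distrib_left distrib_right scale_right_distrib scale_left_distrib
  mult_sc D.add D.scale D_mult zero_prod_def add.assoc add.commute add.left_commute
  mult.assoc mult.commute mult.left_commute

lemma alt_cochainsI:
  assumes "\<And>x y z. \<phi> (x + y) z = \<phi> x z + \<phi> y z" "\<And>c x y. \<phi> (sL c x) y = sL c (\<phi> x y)"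
    and sym: "\<And>x y. \<phi> x y = \<phi> y x" and "\<And>x. \<phi> x x = 0"
  shows "\<phi> \<in> alt_cochains sL"
proof -
  have lin: "Vector_Spaces.linear sL sL (\<lambda>x. \<phi> x z)" for z
    by unfold_locales (simp_all add: assms(1,2))
  then have "Vector_Spaces.linear sL sL (\<phi> z)" for z
    using sym[of z] by presburger
  with lin show ?thesis by (simp add: alt_cochains_def assms(4))
qed

lemma SAD_induct [case_names add e h f D]:
  fixes x :: "('k, 'a) SAD"
  assumes "\<And>x y. P x \<Longrightarrow> P y \<Longrightarrow> P (x + y)"
    and "\<And>a. P (eA a)" "\<And>a. P (hA a)" "\<And>a. P (fA a)" "\<And>t. P (DK t)"
  shows "P x"
proof (cases x)
  case (fields a b c t)
  have "P (((eA a + hA b) + fA c) + DK t)" by (intro assms)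
  then show ?thesis by (simp add: fields)
qed

text \<open>These elements span the algebra additively, so multilinear identities can be checked on them.
  The component of degree zero enters through its two summands, which leaves each element with at
  most one nonzero coordinate.\<close>

definition homogeneous :: "('k, 'a) SAD set"
  where "homogeneous = range eA \<union> range hA \<union> range fA \<union> range DK"

lemma homogeneous_induct:
  fixes x :: "('k, 'a) SAD"
  assumes "\<And>x y. P x \<Longrightarrow> P y \<Longrightarrow> P (x + y)" "\<And>x. x \<in> homogeneous \<Longrightarrow> P x"
  shows "P x"
  by (induction x rule: SAD_induct) (auto simp: homogeneous_def intro: assms)

lemma homogeneous_degree: "x \<in> homogeneous \<Longrightarrow> \<exists>i. x \<in> grL i"
  by (auto simp: homogeneous_def SAD_grading_def zero_prod_def
      intro: exI[of _ "-1"] exI[of _ 0] exI[of _ 1])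

lemma biadditive_eqI:
  fixes \<phi> \<psi> :: "('k, 'a) SAD \<Rightarrow> ('k, 'a) SAD \<Rightarrow> ('k, 'a) SAD"
  assumes "\<And>x y z. \<phi> (x + y) z = \<phi> x z + \<phi> y z" "\<And>x y z. \<phi> z (x + y) = \<phi> z x + \<phi> z y"
    and "\<And>x y z. \<psi> (x + y) z = \<psi> x z + \<psi> y z" "\<And>x y z. \<psi> z (x + y) = \<psi> z x + \<psi> z y"
    and eq: "\<And>x y. x \<in> homogeneous \<Longrightarrow> y \<in> homogeneous \<Longrightarrow> \<phi> x y = \<psi> x y"
  shows "\<phi> = \<psi>"
proof (intro ext)
  fix x y
  have 1: "\<phi> x y = \<psi> x y" if "x \<in> homogeneous" for x y
    by (induction y rule: homogeneous_induct) (simp_all add: assms that)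
  show "\<phi> x y = \<psi> x y"
    by (induction x rule: homogeneous_induct) (simp_all add: assms 1)
qed

lemma d1_add:
  assumes "Vector_Spaces.linear sL sL \<omega>"
  shows "d1 brL \<omega> (x + y) z = d1 brL \<omega> x z + d1 brL \<omega> y z"
    "d1 brL \<omega> z (x + y) = d1 brL \<omega> z x + d1 brL \<omega> z y"
  unfolding d1_def brL_add LL.linear_add[OF assms] by (simp_all add: algebra_simps)

lemma d2_eq_zeroI:
  assumes phi: "\<phi> \<in> alt_cochains sL"
    and eq: "\<And>x y z. x \<in> homogeneous \<Longrightarrow> y \<in> homogeneous \<Longrightarrow> z \<in> homogeneous \<Longrightarrow>
      d2 brL \<phi> x y z = 0"
  shows "d2 brL \<phi> x y z = 0"
proof -
  note add = alt_cochainD(1,2)[OF phi] brL_add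
  have d2_add: "d2 brL \<phi> (x + x') y z = d2 brL \<phi> x y z + d2 brL \<phi> x' y z"
    "d2 brL \<phi> x (y + y') z = d2 brL \<phi> x y z + d2 brL \<phi> x y' z"
    "d2 brL \<phi> x y (z + z') = d2 brL \<phi> x y z + d2 brL \<phi> x y z'" for x x' y y' z z'
    unfolding d2_def add by (simp_all add: algebra_simps)
  have 1: "d2 brL \<phi> x y z = 0" if "x \<in> homogeneous" "y \<in> homogeneous" for x y z
    by (induction z rule: homogeneous_induct) (simp_all add: d2_add eq that)
  have 2: "d2 brL \<phi> x y z = 0" if "x \<in> homogeneous" for x y z
    by (induction y rule: homogeneous_induct) (simp_all add: d2_add 1 that)
  show ?thesis
    by (induction x rule: homogeneous_induct) (simp_all add: d2_add 2)
qed

lemma B2I: "Vector_Spaces.linear sL sL \<omega> \<Longrightarrow> d1 brL \<omega> \<in> B2L"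
  by (simp add: B2_def)

lemma subspace_B2: "C.subspace B2L"
proof (rule C.subspaceI)
  have "d1 brL (\<lambda>_. 0) = 0"
    by (auto simp: d1_def fun_eq_iff zero_prod_def D.zero)
  then show "0 \<in> B2L"
    unfolding B2_def using LL.linear_zero by (metis imageI mem_Collect_eq)
next
  fix \<phi> \<psi> assume "\<phi> \<in> B2L" "\<psi> \<in> B2L"
  then obtain w z where w: "Vector_Spaces.linear sL sL w" "\<phi> = d1 brL w"
    and z: "Vector_Spaces.linear sL sL z" "\<psi> = d1 brL z"
    by (auto simp: B2_def)
  have "\<phi> + \<psi> = d1 brL (\<lambda>x. w x + z x)"
    unfolding w z by (auto simp: d1_def fun_eq_iff brL_add algebra_simps)
  then show "\<phi> + \<psi> \<in> B2L"
    unfolding B2_def using LL.linear_compose_add[OF w(1) z(1)] by blast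
next
  fix c \<phi> assume "\<phi> \<in> B2L"
  then obtain w where w: "Vector_Spaces.linear sL sL w" "\<phi> = d1 brL w"
    by (auto simp: B2_def)
  have "cochain_scale sL c \<phi> = d1 brL (\<lambda>x. sL c (w x))"
    unfolding w by (auto simp: d1_def cochain_scale_def fun_eq_iff SAD_br_linear L.scale_right_diff_distrib)
  then show "cochain_scale sL c \<phi> \<in> B2L"
    unfolding B2_def using LL.linear_compose_scale_right[OF w(1)] by blast
qed


section \<open>Weights other than two\<close>

text \<open>Cartan's homotopy formula: for $\omega = \varphi(h\otimes 1, \cdot)$, a cocycle $\varphi$
  satisfies $d\omega = (\mathrm{ad}(h\otimes 1))\cdot\varphi$. On elements of degrees $i$ and $j$ the
  right-hand side is $((i+j+\mu)-i-j)\varphi = \mu\varphi$, which equals $\varphi$ for odd $\mu$.\<close>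

lemma odd_weight_coboundary:
  assumes phi: "\<phi> \<in> weight_cocycles sL brL grL \<mu>" and odd: "odd \<mu>"
  shows "\<phi> \<in> B2L"
proof -
  have alt: "\<phi> \<in> alt_cochains sL" and cyc: "\<And>x y z. d2 brL \<phi> x y z = 0"
    and wt: "has_weight grL \<mu> \<phi>"
    using phi by (auto simp: weight_cocycles_def Z2_def)
  note A = alt_cochainD[OF alt]
  define \<omega> where "\<omega> = \<phi> (hA 1)"
  have lin: "Vector_Spaces.linear sL sL \<omega>"
    using alt by (simp add: \<omega>_def alt_cochains_def)
  have ad_h: "brL (hA 1) x = (if odd i then x else 0)" if "x \<in> grL i" for i x
    using that by (auto simp: SAD_grading_def D_one char2_simps zero_prod_def D.zero split: if_splits)
  have "\<phi> = d1 brL \<omega>"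
  proof (rule biadditive_eqI)
    fix x y assume "x \<in> homogeneous" "y \<in> homogeneous"
    then obtain i j where x: "x \<in> grL i" and y: "y \<in> grL j"
      using homogeneous_degree by metis
    have xy: "\<phi> x y \<in> grL (i + j + \<mu>)"
      using wt x y by (simp add: has_weight_def)
    have "d1 brL \<omega> x y + d2 brL \<phi> (hA 1) x y =
        brL (hA 1) (\<phi> x y) + \<phi> (brL (hA 1) x) y + \<phi> x (brL (hA 1) y)"
      unfolding d1_def d2_def \<omega>_def diff_L A(8)[of "brL x y" "hA 1"]
        A(8)[of "brL (hA 1) y" x]
      by (simp add: double_L cancel_L ac_simps)
    also have "\<dots> = \<phi> x y"
      unfolding ad_h[OF x] ad_h[OF y] ad_h[OF xy] using odd
      by (auto simp: A double_L)
    finally show "\<phi> x y = d1 brL \<omega> x y" by (simp add: cyc)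
  qed (rule A d1_add[OF lin])+
  then show ?thesis using lin by (auto simp: B2_def)
qed

lemma large_weight_zero:
  assumes phi: "\<phi> \<in> weight_cocycles sL brL grL \<mu>" and mu: "\<mu> \<ge> 4"
  shows "\<phi> = 0"
proof -
  have alt: "\<phi> \<in> alt_cochains sL" and wt: "has_weight grL \<mu> \<phi>"
    using phi by (auto simp: weight_cocycles_def Z2_def)
  note A = alt_cochainD[OF alt]
  show ?thesis
  proof (rule biadditive_eqI)
    fix x y assume "x \<in> homogeneous" "y \<in> homogeneous"
    then obtain i j where x: "x \<in> grL i" and y: "y \<in> grL j"
      using homogeneous_degree by metis
    have xy: "\<phi> x y \<in> grL (i + j + \<mu>)"
      using wt x y by (simp add: has_weight_def)
    have "x = 0 \<or> i \<ge> -1" "y = 0 \<or> j \<ge> -1"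
      using x y by (auto simp: SAD_grading_def split: if_splits)
    then show "\<phi> x y = 0 x y"
      using xy mu by (auto simp: A SAD_grading_def split: if_splits)
  qed (simp_all add: A)
qed


section \<open>The basic cocycles\<close>

lemma XiD:
  assumes "\<xi> \<in> Xi sc D"
  shows "Vector_Spaces.linear sc (*) \<xi>" "\<xi> (a * a) = 0" "\<xi> (D a) = 0"
    "sc (\<xi> a) (D b) = sc (\<xi> b) (D a)"
proof -
  have "sc (\<xi> a) (D b) + sc (\<xi> b) (D a) = 0"
    using assms unfolding Xi_def by blast
  then show "sc (\<xi> a) (D b) = sc (\<xi> b) (D a)" by (rule eq_iff_sum_zero[THEN iffD2])
  show "Vector_Spaces.linear sc (*) \<xi>" "\<xi> (D a) = 0"
    using assms by (simp_all add: Xi_def)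
  have "a * a \<in> squares_span sc"
    unfolding squares_span_def by (intro span_base) (auto simp: power2_eq_square)
  then show "\<xi> (a * a) = 0" using assms by (simp add: Xi_def)
qed

text \<open>The cubic identity in \<open>Xi\<close> holds because each of its three summands vanishes: the symmetry
  of $\xi(a)D(b)$ turns $(\xi(a)b+\xi(b)a+\xi(ab)1)D(c)$ into
  $\xi(c)(bD(a)+aD(b)) + \xi(c)D(ab)$, and the two terms agree.\<close>

lemma XiI:
  assumes lin: "Vector_Spaces.linear sc (*) \<xi>" and sq: "\<And>a. \<xi> (a * a) = 0"
    and der: "\<And>a. \<xi> (D a) = 0" and sym: "\<And>a b. sc (\<xi> a) (D b) = sc (\<xi> b) (D a)"
  shows "\<xi> \<in> Xi sc D"
proof -
  interpret xi: Vector_Spaces.linear sc "(*)" \<xi> by (rule lin)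
  have sq_span: "squares_span sc \<subseteq> {a. \<xi> a = 0}"
    unfolding squares_span_def
    by (intro span_minimal xi.subspace_kernel) (auto simp: power2_eq_square sq)
  have "(sc (\<xi> a) b + sc (\<xi> b) a + sc (\<xi> (a * b)) 1) * D c = 0" for a b c
  proof -
    have "(sc (\<xi> a) b + sc (\<xi> b) a + sc (\<xi> (a * b)) 1) * D c =
        b * sc (\<xi> a) (D c) + a * sc (\<xi> b) (D c) + sc (\<xi> (a * b)) (D c)"
      by (simp add: mult_sc algebra_simps)
    also have "\<dots> = b * sc (\<xi> c) (D a) + a * sc (\<xi> c) (D b) + sc (\<xi> c) (D (a * b))"
      by (simp only: sym[of _ c])
    also have "\<dots> = 0"
      by (simp add: mult_sc D_mult scale_right_distrib char2_simps ac_simps)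
    finally show ?thesis .
  qed
  then have "(sc (\<xi> a) b + sc (\<xi> b) a + sc (\<xi> (a * b)) 1) * D c +
      (sc (\<xi> c) a + sc (\<xi> a) c + sc (\<xi> (c * a)) 1) * D b +
      (sc (\<xi> b) c + sc (\<xi> c) b + sc (\<xi> (b * c)) 1) * D a = 0" for a b c
    by (simp only: add_0_left)
  moreover have "sc (\<xi> a) (D b) + sc (\<xi> b) (D a) = 0" for a b
    by (metis sym double)
  ultimately show ?thesis
    unfolding Xi_def using lin der sq_span by blast
qed

lemma cocycle_i_Z2:
  assumes "v \<in> constants D"
  shows "cocycle_i v \<in> Z2 sL brL"
proof -
  have Dv: "D v = 0" using assms by (simp add: constants_def)
  have "cocycle_i v \<in> alt_cochains sL"
    by (rule alt_cochainsI; clarsimp simp: normalize)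
  moreover have "d2 brL (cocycle_i v) x y z = 0"
    if "x \<in> homogeneous" "y \<in> homogeneous" "z \<in> homogeneous" for x y z
    using that unfolding homogeneous_def
    by (elim UnE rangeE; hypsubst) (simp_all add: d2_def normalize Dv)
  ultimately show ?thesis by (simp add: Z2_def d2_eq_zeroI)
qed

lemma cocycle_ii_Z2: "cocycle_ii sc v \<in> Z2 sL brL"
proof -
  have "cocycle_ii sc v \<in> alt_cochains sL"
    by (rule alt_cochainsI; clarsimp simp: normalize)
  moreover have "d2 brL (cocycle_ii sc v) x y z = 0"
    if "x \<in> homogeneous" "y \<in> homogeneous" "z \<in> homogeneous" for x y z
    using that unfolding homogeneous_def
    by (elim UnE rangeE; hypsubst) (simp_all add: d2_def normalize)
  ultimately show ?thesis by (simp add: Z2_def d2_eq_zeroI)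
qed

lemma cocycle_iii_Z2:
  assumes "\<xi> \<in> Xi sc D"
  shows "cocycle_iii sc D \<xi> \<in> Z2 sL brL"
proof -
  note X = XiD[OF assms]
  interpret xi: Vector_Spaces.linear sc "(*)" \<xi> by (rule X)
  have alt: "cocycle_iii sc D \<xi> \<in> alt_cochains sL"
    by (rule alt_cochainsI; clarsimp simp: normalize xi.add xi.scale X(2))
  \<comment> \<open>By the symmetry of \<open>\<xi>(a) D(b)\<close>, the map \<open>\<xi>\<close> can always be evaluated at a single variable, and
    the vanishing on \<open>D(A)\<close> gives integration by parts.\<close>
  have prod: "sc (\<xi> (a * b)) (D c) = sc (\<xi> c) (a * D b) + sc (\<xi> c) (b * D a)" for a b c
    by (simp add: X(4)[of _ c] D_mult scale_right_distrib ac_simps)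
  have comm: "sc (\<xi> a) (b * D c) = sc (\<xi> c) (b * D a)" for a b c
    by (metis X(4) mult_sc(2))
  then have comm': "sc (\<xi> a) (D c * b) = sc (\<xi> c) (D a * b)" for a b c
    by (metis mult.commute)
  have parts: "\<xi> (D a * b) + \<xi> (D b * a) = 0" for a b
    using X(3)[of "a * b"] by (simp add: D_mult xi.add ac_simps)
  have parts: "\<xi> (D a * b) = \<xi> (D b * a)" for a b
    using parts[of a b] by (metis diff_k eq_iff_diff_eq_0)
  then have parts': "\<xi> (a * D b) = \<xi> (b * D a)" for a b
    by (metis mult.commute)
  have "d2 brL (cocycle_iii sc D \<xi>) x y z = 0"
    if "x \<in> homogeneous" "y \<in> homogeneous" "z \<in> homogeneous" for x y z
    using that unfolding homogeneous_def
    by (elim UnE rangeE; hypsubst)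
      (simp_all add: d2_def normalize xi.zero xi.add xi.scale X(3),
        simp_all add: prod X(4) comm comm' parts parts' normalize)
  then show ?thesis by (simp add: Z2_def alt d2_eq_zeroI)
qed

lemma grading_mem: "eA a \<in> grL (-1)" "hA a \<in> grL 0" "fA a \<in> grL 1" "DK t \<in> grL 0"
  by (auto simp: SAD_grading_def)

text \<open>A value on elements of degrees $i$ and $j$ has degree $i+j+2 \leq 1$ unless it vanishes; by
  symmetry this leaves the pairs $(-1,-1)$ and $(-1,0)$ to consider.\<close>

lemma has_weight_twoI:
  fixes \<phi> :: "('k, 'a) SAD \<Rightarrow> ('k, 'a) SAD \<Rightarrow> ('k, 'a) SAD"
  assumes alt: "\<phi> \<in> alt_cochains sL"
    and ee: "\<And>a b. \<phi> (eA a) (eA b) \<in> grL 0"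
    and e0: "\<And>a b t. \<phi> (eA a) (0, b, 0, t) \<in> grL 1"
    and van: "\<And>b c t b' c' t'. \<phi> (0, b, c, t) (0, b', c', t') = 0" "\<And>a c. \<phi> (eA a) (fA c) = 0"
  shows "has_weight grL 2 \<phi>"
proof -
  note A = alt_cochainD[OF alt]
  have 0: "0 \<in> grL i" for i by (auto simp: SAD_grading_def zero_prod_def)
  have gr: "x = 0 \<or> i = -1 \<and> x \<in> range eA \<or> i = 0 \<and> (\<exists>b t. x = (0, b, 0, t)) \<or> i = 1 \<and> x \<in> range fA"
    if "x \<in> grL i" for x i
    using that by (auto simp: SAD_grading_def split: if_splits)
  have e0': "\<phi> (0, b, 0, t) (eA a) \<in> grL 1" for a b t
    unfolding A(8)[of "(0, b, 0, t)"] by (rule e0)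
  have van': "\<phi> (fA c) (eA a) = 0" for a c
    unfolding A(8)[of "fA c"] by (rule van)
  show ?thesis unfolding has_weight_def
  proof (intro allI ballI)
    fix i j x y assume "x \<in> grL i" "y \<in> grL j"
    from this[THEN gr] show "\<phi> x y \<in> grL (i + j + 2)"
      by (elim disjE conjE exE rangeE; hypsubst) (simp_all add: A(5,6) 0 ee e0 e0' van van')
  qed
qed

lemma basic_weight_two:
  "v \<in> constants D \<Longrightarrow> has_weight grL 2 (cocycle_i v)" "has_weight grL 2 (cocycle_ii sc v)"
  "\<xi> \<in> Xi sc D \<Longrightarrow> has_weight grL 2 (cocycle_iii sc D \<xi>)"
proof -
  have gr: "(0, b, 0, t) \<in> grL 0" "fA a \<in> grL 1" for a b t
    by (auto simp: SAD_grading_def)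
  show "has_weight grL 2 (cocycle_i v)" if "v \<in> constants D"
    using cocycle_i_Z2[OF that] by (intro has_weight_twoI) (simp_all add: Z2_def gr zero_prod_def)
  show "has_weight grL 2 (cocycle_ii sc v)"
    using cocycle_ii_Z2 by (intro has_weight_twoI) (simp_all add: Z2_def gr zero_prod_def)
  assume xi: "\<xi> \<in> Xi sc D"
  then interpret xi: Vector_Spaces.linear sc "(*)" \<xi> by (rule XiD)
  show "has_weight grL 2 (cocycle_iii sc D \<xi>)"
    using cocycle_iii_Z2[OF xi] by (intro has_weight_twoI)
      (simp_all add: Z2_def gr zero_prod_def xi.zero)
qed

text \<open>The coboundary of $e\otimes a \mapsto f\otimes za$ involves $D(z)$ on the pairs of $e\otimes a$ with
  \<open>D\<close>; on the other pairs its terms are products without derivatives, which cancel in twos.\<close>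

lemma cocycle_ii_coboundary: "cocycle_ii sc (D z) \<in> B2L"
proof -
  define \<omega> :: "('k, 'a) SAD \<Rightarrow> ('k, 'a) SAD" where "\<omega> x = fA (z * fst x)" for x
  have "Vector_Spaces.linear sL sL \<omega>"
    by unfold_locales (clarsimp simp: \<omega>_def normalize)+
  then have "d1 brL \<omega> \<in> B2L" by (rule B2I)
  moreover have "cocycle_ii sc (D z) x y = d1 brL \<omega> x y" for x y
    by (cases x; cases y) (simp add: d1_def \<omega>_def, simp only: normalize add_0_left)
  then have "cocycle_ii sc (D z) = d1 brL \<omega>" by blast
  ultimately show ?thesis by simp
qed

definition basic :: "'a \<Rightarrow> 'a \<Rightarrow> ('a \<Rightarrow> 'k) \<Rightarrow> ('k, 'a) SAD \<Rightarrow> ('k, 'a) SAD \<Rightarrow> ('k, 'a) SAD"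
  where "basic v u \<xi> = cocycle_i v + cocycle_ii sc u + cocycle_iii sc D \<xi>"

lemma basic_add: "basic (v + v') (u + u') (\<xi> + \<xi>') = basic v u \<xi> + basic v' u' \<xi>'"
proof (intro ext)
  fix x y
  show "basic (v + v') (u + u') (\<xi> + \<xi>') x y = (basic v u \<xi> + basic v' u' \<xi>') x y"
    by (cases x; cases y) (simp add: basic_def algebra_simps)
qed

lemma basic_scale: "basic (sc c v) (sc c u) (\<lambda>a. c * \<xi> a) = cochain_scale sL c (basic v u \<xi>)"
proof (intro ext)
  fix x y
  show "basic (sc c v) (sc c u) (\<lambda>a. c * \<xi> a) x y = cochain_scale sL c (basic v u \<xi>) x y"
    by (cases x; cases y) (simp add: basic_def cochain_scale_def mult_sc algebra_simps)
qed

lemma basic_single: "basic v 0 0 = cocycle_i v" "basic 0 u 0 = cocycle_ii sc u"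
  "basic 0 0 \<xi> = cocycle_iii sc D \<xi>"
proof -
  have "basic v 0 0 x y = cocycle_i v x y" "basic 0 u 0 x y = cocycle_ii sc u x y"
    "basic 0 0 \<xi> x y = cocycle_iii sc D \<xi> x y" for x y
    by (cases x; cases y; simp add: basic_def)+
  then show "basic v 0 0 = cocycle_i v" "basic 0 u 0 = cocycle_ii sc u"
    "basic 0 0 \<xi> = cocycle_iii sc D \<xi>" by blast+
qed

text \<open>A coboundary \<open>d\<omega>\<close> has no \<open>D\<close>-component at $(e\otimes a, e\otimes 1)$, since brackets have none
  and these two elements commute; this kills $\xi$. Its $f$-components at $(e\otimes 1, h\otimes 1)$
  and $(e\otimes 1, D)$ are $2w = 0$ and $D(w)$ for the $f$-component $w$ of $\omega(e\otimes 1)$,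
  because no bracket with $e\otimes 1$ has an $f$-component.\<close>

lemma basic_coboundaryD:
  assumes xi: "\<xi> \<in> Xi sc D" and B: "basic v u \<xi> \<in> B2L"
  shows "v = 0" "u \<in> range D" "\<xi> = 0"
proof -
  interpret xi: Vector_Spaces.linear sc "(*)" \<xi> using xi by (rule XiD)
  obtain \<omega> where lin: "Vector_Spaces.linear sL sL \<omega>" and eq: "basic v u \<xi> = d1 brL \<omega>"
    using B by (auto simp: B2_def)
  have om0: "\<omega> (0, 0, 0, 0) = (0, 0, 0, 0)"
    using LL.linear_0[OF lin] by (simp add: zero_prod_def)
  have val: "cocycle_i v x y + cocycle_ii sc u x y + cocycle_iii sc D \<xi> x y =
      brL x (\<omega> y) + brL y (\<omega> x) + \<omega> (brL x y)" for x y
    using fun_cong[OF fun_cong[OF eq], of x y] by (simp add: basic_def d1_def diff_L)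
  obtain a b w t where e1: "\<omega> (eA 1) = (a, b, w, t)" by (cases "\<omega> (eA 1)")
  obtain a' b' c' t' where h1: "\<omega> (hA 1) = (a', b', c', t')" by (cases "\<omega> (hA 1)")
  obtain a'' b'' c'' t'' where D1: "\<omega> (DK 1) = (a'', b'', c'', t'')" by (cases "\<omega> (DK 1)")
  have "\<xi> x = 0" for x
    using val[of "eA x" "eA 1"] by (cases "\<omega> (eA x)") (simp add: e1 om0 normalize xi.zero D_one)
  then show "\<xi> = 0" by auto
  show "v = 0"
    using val[of "eA 1" "hA 1"] by (simp add: e1 h1 om0 normalize D_one)
  then have "u = D w"
    using val[of "eA 1" "DK 1"] by (simp add: e1 D1 om0 normalize D_one)
  then show "u \<in> range D" by blast
qed


section \<open>Cocycles of weight two\<close>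

text \<open>Each parameter is read off from the values of \<open>\<phi>\<close> with an argument equal to one. The summand
  $au$ in $w(a)$ is what makes $w(1)$ vanish, so that the coboundary of $e\otimes a\mapsto f\otimes w(a)$
  leaves $P(1,1)$ to the cocycle of the first type.\<close>

lemma weight_two_decomposition:
  assumes phi: "\<phi> \<in> weight_cocycles sL brL grL 2"
  obtains u v \<xi> \<beta> where "u \<in> constants D" "\<xi> \<in> Xi sc D" "\<beta> \<in> B2L"
    "\<phi> = basic u v \<xi> + \<beta>"
proof -
  have alt: "\<phi> \<in> alt_cochains sL" and cyc: "\<And>x y z. d2 brL \<phi> x y z = 0"
    and wt: "has_weight grL 2 \<phi>"
    using phi by (auto simp: weight_cocycles_def Z2_def)
  note A = alt_cochainD[OF alt]
  have wtD: "\<phi> x y \<in> grL (i + j + 2)" if "x \<in> grL i" "y \<in> grL j" for i j x y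
    using wt that by (simp add: has_weight_def)
  define G where "G a b = fst (snd (\<phi> (eA a) (eA b)))" for a b
  define g where "g a b = snd (snd (snd (\<phi> (eA a) (eA b))))" for a b
  define P where "P a b = fst (snd (snd (\<phi> (eA a) (hA b))))" for a b
  define p where "p a = fst (snd (snd (\<phi> (eA a) (DK 1))))" for a
  have ee: "\<phi> (eA a) (eA b) = (0, G a b, 0, g a b)" for a b
    using wtD[OF grading_mem(1) grading_mem(1), of a b]
    by (auto simp: SAD_grading_def G_def g_def)
  have eh: "\<phi> (eA a) (hA b) = fA (P a b)" for a b
    using wtD[OF grading_mem(1) grading_mem(2), of a b] by (auto simp: SAD_grading_def P_def)
  have "\<phi> (eA a) (DK 1) = fA (p a)" for a
    using wtD[OF grading_mem(1) grading_mem(4), of a 1] by (auto simp: SAD_grading_def p_def)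
  then have eD: "\<phi> (eA a) (DK t) = fA (sc t (p a))" for a t
    using A(4)[of "eA a" t "DK 1"] by simp
  have zero: "\<phi> (eA a) (fA b) = (0, 0, 0, 0)" "\<phi> (hA a) (hA b) = (0, 0, 0, 0)"
    "\<phi> (hA a) (fA b) = (0, 0, 0, 0)" "\<phi> (hA a) (DK t) = (0, 0, 0, 0)"
    "\<phi> (fA a) (fA b) = (0, 0, 0, 0)" "\<phi> (fA a) (DK t) = (0, 0, 0, 0)"
    "\<phi> (DK s) (DK t) = (0, 0, 0, 0)" for a b s t
    using wtD[OF grading_mem(1) grading_mem(3), of a b] wtD[OF grading_mem(2) grading_mem(2), of a b]
      wtD[OF grading_mem(2) grading_mem(3), of a b] wtD[OF grading_mem(2) grading_mem(4), of a t]
      wtD[OF grading_mem(3) grading_mem(3), of a b] wtD[OF grading_mem(3) grading_mem(4), of a t]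
      wtD[OF grading_mem(4) grading_mem(4), of s t]
    by (simp_all add: SAD_grading_def zero_prod_def)
  note sym = A(8)[of "hA b" "eA a" for a b] A(8)[of "fA b" "eA a" for a b]
    A(8)[of "DK t" "eA a" for a t] A(8)[of "fA b" "hA a" for a b]
    A(8)[of "DK t" "hA a" for a t] A(8)[of "DK t" "fA a" for a t]
  note vals = ee eh eD zero sym[unfolded eh eD zero]
  have G0: "G 0 b = 0" "G b 0 = 0" and g0: "g 0 b = 0" "g b 0 = 0"
    and P0: "P 0 b = 0" "P b 0 = 0" and p0: "p 0 = 0" for b
    using A(5,6) by (simp_all add: G_def g_def P_def p_def zero_prod_def)
  note zeros = G0 g0 P0 p0
  have g_sym: "g a b = g b a" for a b
    unfolding g_def by (metis A(8))
  have P_lin: "P a (b + c) = P a b + P a c" "P a (sc k b) = sc k (P a b)" for a b c k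
    using A(2)[of "eA a" "hA b" "hA c"] A(4)[of "eA a" k "hA b"] by (simp_all add: eh)
  have g_lin: "g (b + c) a = g b a + g c a" "g (sc k b) a = k * g b a" for a b c k
    using A(1)[of "eA b" "eA c" "eA a"] A(3)[of k "eA b" "eA a"] by (simp_all add: ee)

  \<comment> \<open>The cocycle equations; the names tell the types of the three arguments.\<close>
  have eeh: "g (a * c) b + g (b * c) a = 0" for a b c
    using cyc[of "eA a" "eA b" "hA c"] by (simp add: d2_def vals zeros normalize)
  have eeD: "g (D a) b + g (D b) a = 0" for a b
    using cyc[of "eA a" "eA b" "DK 1"] by (simp add: d2_def vals zeros normalize)
  have eef: "c * G a b + sc (g a b) (D c) + P b (a * c) + P a (b * c) = 0" for a b c
    using cyc[of "eA a" "eA b" "fA c"] by (simp add: d2_def vals zeros normalize)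
  have ehh: "b * P a c + c * P a b + P (a * b) c + P (a * c) b = 0" for a b c
    using cyc[of "eA a" "hA b" "hA c"] by (simp add: d2_def vals zeros normalize)
  have ehD: "b * p a + D (P a b) + p (a * b) + P (D a) b + P a (D b) = 0" for a b
    using cyc[of "eA a" "hA b" "DK 1"] by (simp add: d2_def vals zeros normalize)

  define u where "u = P 1 1"
  define q where "q = p 1"
  define \<xi> where "\<xi> a = g a 1" for a
  define w where "w b = P 1 b + b * u" for b
  define \<omega> :: "('k, 'a) SAD \<Rightarrow> ('k, 'a) SAD" where "\<omega> x = fA (w (fst x))" for x

  \<comment> \<open>Putting an argument equal to one in the equations solves them for \<open>g\<close>, \<open>G\<close>, \<open>P\<close> and \<open>p\<close>.\<close>
  have gval: "g a b = \<xi> (a * b)" for a b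
  proof -
    have "g (a * b) 1 + g b a = 0" using eeh[of a b 1] by simp
    then show ?thesis unfolding \<xi>_def by (metis diff_k eq_iff_diff_eq_0 g_sym)
  qed
  have P_swap: "P b c + P c b = b * w c + c * w b" for b c
    using ehh[of b 1 c] unfolding eq_iff_sum_zero[of "P b c + P c b"]
    by (simp add: w_def normalize)
  have w1: "w 1 = 0" by (simp add: w_def u_def double)
  have Gval: "G a b = a * w b + b * w a" for a b
    using eef[of 1 a b] P_swap[of a b]
    by (simp add: D_one) (metis add.assoc add.commute eq_iff_sum_zero)
  have Pval: "P b c = c * w b + w (b * c) + b * c * u + sc (\<xi> b) (D c)" for b c
    using eef[of c 1 b] unfolding eq_iff_sum_zero[of "P b c"]
    by (simp add: Gval w1 gval w_def u_def normalize)
  \<comment> \<open>Symmetrizing the first three summands of \<open>P\<close> already gives the right-hand side of \<open>P_swap\<close>,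
    so the last summand must be symmetric.\<close>
  have xi_sym: "sc (\<xi> b) (D c) = sc (\<xi> c) (D b)" for b c
    using P_swap[of b c] unfolding eq_iff_sum_zero[of "sc (\<xi> b) (D c)"] Pval
    by (simp add: normalize)
  have Du: "D u = 0"
    using ehD[of 1 1] by (simp add: D_one zeros u_def normalize)
  have pval: "p b = b * q + D (w b) + w (D b)" for b
    using ehD[of b 1] unfolding eq_iff_sum_zero[of "p b"]
    by (simp add: D_one zeros w_def q_def Du normalize)

  have "Vector_Spaces.linear sc (*) \<xi>"
    by unfold_locales (simp_all add: \<xi>_def g_lin algebra_simps)
  moreover have "\<xi> (a * a) = 0" for a
    using A(7)[of "eA a"] ee[of a a] by (simp add: gval zero_prod_def)
  moreover have "\<xi> (D a) = 0" for a
    using eeD[of a 1] by (simp add: \<xi>_def D_one zeros)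
  ultimately have xi: "\<xi> \<in> Xi sc D" using xi_sym by (intro XiI)
  interpret xi: Vector_Spaces.linear sc "(*)" \<xi> using xi by (rule XiD)
  have om: "Vector_Spaces.linear sL sL \<omega>"
    by unfold_locales (auto simp: \<omega>_def w_def P_lin normalize)
  have u: "u \<in> constants D" by (simp add: constants_def Du)
  have alts: "cocycle_i u \<in> alt_cochains sL" "cocycle_ii sc q \<in> alt_cochains sL"
    "cocycle_iii sc D \<xi> \<in> alt_cochains sL"
    using cocycle_i_Z2[OF u] cocycle_ii_Z2[of q] cocycle_iii_Z2[OF xi] by (auto simp: Z2_def)
  have w0: "w 0 = 0" by (simp add: w_def zeros)
  have w_scale: "w (sc t a) = sc t (w a)" for t a
    by (simp add: w_def P_lin mult_sc scale_right_distrib)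
  have "\<phi> = basic u q \<xi> + d1 brL \<omega>"
  proof (rule biadditive_eqI)
    fix x y assume "x \<in> homogeneous" "y \<in> homogeneous"
    then show "\<phi> x y = (basic u q \<xi> + d1 brL \<omega>) x y"
      unfolding homogeneous_def
      by (elim UnE rangeE; hypsubst)
        (simp_all only: vals basic_def d1_def \<omega>_def plus_fun_apply cocycle_i.simps
          cocycle_ii.simps cocycle_iii.simps SAD_br.simps fst_conv add_Pair diff_Pair Gval gval Pval
          pval mult_zero_left mult_zero_right D.zero scale_zero_left scale_zero_right w0 w_scale
          xi.zero char2_simps add_0_left add_0_right xi_sym distrib_left scale_right_distrib
          mult.assoc mult.commute mult.left_commute
          add.assoc add.commute add.left_commute)
  qed (simp_all add: A(1,2) d1_add[OF om] basic_def alts[THEN alt_cochainD(1)]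
      alts[THEN alt_cochainD(2)] algebra_simps)
  moreover have "d1 brL \<omega> \<in> B2L" using om by (rule B2I)
  ultimately show ?thesis using that u xi by blast
qed


section \<open>The positive part of the cohomology\<close>

lemma constants_closed:
  "0 \<in> constants D" "v \<in> constants D \<Longrightarrow> v' \<in> constants D \<Longrightarrow> v + v' \<in> constants D"
  "v \<in> constants D \<Longrightarrow> sc c v \<in> constants D"
  by (simp_all add: constants_def D_simps)

lemma subspace_range_D: "subspace (range D)"
  using D.subspace_image[OF subspace_UNIV] .

lemma Xi_closed:
  "0 \<in> Xi sc D" "\<xi> \<in> Xi sc D \<Longrightarrow> \<xi>' \<in> Xi sc D \<Longrightarrow> \<xi> + \<xi>' \<in> Xi sc D"
  "\<xi> \<in> Xi sc D \<Longrightarrow> (\<lambda>a. c * \<xi> a) \<in> Xi sc D"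
proof -
  have "vector_space ((*) :: 'k \<Rightarrow> 'k \<Rightarrow> 'k)"
    by unfold_locales (simp_all add: algebra_simps)
  then have lin: "Vector_Spaces.linear sc (*) \<xi> \<longleftrightarrow>
      (\<forall>x y. \<xi> (x + y) = \<xi> x + \<xi> y) \<and> (\<forall>c x. \<xi> (sc c x) = c * \<xi> x)" for \<xi> :: "'a \<Rightarrow> 'k"
    using vector_space_axioms by (simp add: Vector_Spaces.linear_iff)
  show "0 \<in> Xi sc D" by (rule XiI) (simp_all add: lin)
  show "\<xi> + \<xi>' \<in> Xi sc D" if "\<xi> \<in> Xi sc D" "\<xi>' \<in> Xi sc D"
    by (rule XiI)
      (use XiD(1)[OF that(1)] XiD(1)[OF that(2)] XiD(4)[OF that(1)] XiD(4)[OF that(2)] in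
        \<open>simp_all add: lin XiD(2,3)[OF that(1)] XiD(2,3)[OF that(2)] algebra_simps\<close>)
  show "(\<lambda>a. c * \<xi> a) \<in> Xi sc D" if "\<xi> \<in> Xi sc D"
  proof (rule XiI)
    show "sc (c * \<xi> a) (D b) = sc (c * \<xi> b) (D a)" for a b
      using XiD(4)[OF that, of a b] by (metis scale_scale)
  qed (use XiD(1)[OF that] in \<open>simp_all add: lin XiD(2,3)[OF that] algebra_simps\<close>)
qed

definition positive_cocycles :: "(('k, 'a) SAD \<Rightarrow> ('k, 'a) SAD \<Rightarrow> ('k, 'a) SAD) set"
  where "positive_cocycles =
    {basic v u \<xi> + \<beta> | v u \<xi> \<beta>. v \<in> constants D \<and> \<xi> \<in> Xi sc D \<and> \<beta> \<in> B2L}"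

lemma positive_cocyclesI:
  "v \<in> constants D \<Longrightarrow> \<xi> \<in> Xi sc D \<Longrightarrow> \<beta> \<in> B2L \<Longrightarrow> basic v u \<xi> + \<beta> \<in> positive_cocycles"
  unfolding positive_cocycles_def by blast

lemma basic_zero: "basic 0 0 0 = 0"
  using basic_add[of 0 0 0 0 0 0] by simp

lemma subspace_positive_cocycles: "C.subspace positive_cocycles"
proof (rule C.subspaceI)
  have "basic 0 0 0 + 0 \<in> positive_cocycles"
    by (intro positive_cocyclesI constants_closed Xi_closed C.subspace_0[OF subspace_B2])
  then show "0 \<in> positive_cocycles" by (simp add: basic_zero)
next
  fix \<phi> \<psi> assume "\<phi> \<in> positive_cocycles" "\<psi> \<in> positive_cocycles"
  then obtain v u \<xi> \<beta> v' u' \<xi>' \<beta>' where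
    in1: "v \<in> constants D" "\<xi> \<in> Xi sc D" "\<beta> \<in> B2L" and 1: "\<phi> = basic v u \<xi> + \<beta>" and
    in2: "v' \<in> constants D" "\<xi>' \<in> Xi sc D" "\<beta>' \<in> B2L" and 2: "\<psi> = basic v' u' \<xi>' + \<beta>'"
    unfolding positive_cocycles_def by blast
  have "\<phi> + \<psi> = basic (v + v') (u + u') (\<xi> + \<xi>') + (\<beta> + \<beta>')"
    by (simp add: 1 2 basic_add algebra_simps)
  then show "\<phi> + \<psi> \<in> positive_cocycles"
    using in1 in2 by (simp add: positive_cocyclesI constants_closed Xi_closed
        C.subspace_add[OF subspace_B2])
next
  fix c \<phi> assume "\<phi> \<in> positive_cocycles"
  then obtain v u \<xi> \<beta> where
    in1: "v \<in> constants D" "\<xi> \<in> Xi sc D" "\<beta> \<in> B2L" and 1: "\<phi> = basic v u \<xi> + \<beta>"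
    unfolding positive_cocycles_def by blast
  have "cochain_scale sL c \<phi> =
      basic (sc c v) (sc c u) (\<lambda>a. c * \<xi> a) + cochain_scale sL c \<beta>"
    by (simp add: 1 basic_scale C.scale_right_distrib)
  then show "cochain_scale sL c \<phi> \<in> positive_cocycles"
    using in1 by (simp add: positive_cocyclesI constants_closed Xi_closed
        C.subspace_scale[OF subspace_B2])
qed

lemma B2_subset_positive_cocycles: "B2L \<subseteq> positive_cocycles"
proof
  fix \<beta> assume "\<beta> \<in> B2L"
  then have "basic 0 0 0 + \<beta> \<in> positive_cocycles"
    by (intro positive_cocyclesI constants_closed Xi_closed)
  then show "\<beta> \<in> positive_cocycles" by (simp add: basic_zero)
qed

lemma weight_cocycles_subset_positive_cocycles:
  assumes "\<mu> > 0"
  shows "weight_cocycles sL brL grL \<mu> \<subseteq> positive_cocycles"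
proof
  fix \<phi> assume phi: "\<phi> \<in> weight_cocycles sL brL grL \<mu>"
  have "odd \<mu> \<or> \<mu> = 2 \<or> \<mu> \<ge> 4" using assms by presburger
  then consider "odd \<mu>" | "\<mu> = 2" | "\<mu> \<ge> 4" by blast
  then show "\<phi> \<in> positive_cocycles"
  proof cases
    case 1
    then show ?thesis using odd_weight_coboundary[OF phi] B2_subset_positive_cocycles by blast
  next
    case 2
    then show ?thesis using weight_two_decomposition[of \<phi>] phi positive_cocyclesI by metis
  next
    case 3
    then show ?thesis
      using large_weight_zero[OF phi] C.subspace_0[OF subspace_positive_cocycles] by simp
  qed
qed

text \<open>The span contains all coboundaries, as these are the members of the zero class, and so
  \<open>positive_cocycles\<close> is the full preimage of the positive part of the cohomology.\<close>

lemma span_weight_cocycles: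
  "C.span (\<Union>\<mu>\<in>{0<..}. \<Union> (H2_weight sL brL grL \<mu>)) = positive_cocycles"
    (is "C.span ?U = _")
proof
  have "?U \<subseteq> positive_cocycles"
  proof (clarsimp simp: H2_weight_def H2_class_def elt_set_plus_def)
    fix \<mu> :: int and \<phi> \<beta>
    assume "0 < \<mu>" "\<phi> \<in> C.span (weight_cocycles sL brL grL \<mu>)" "\<beta> \<in> B2L"
    then show "\<phi> + \<beta> \<in> positive_cocycles"
      using C.span_minimal[OF weight_cocycles_subset_positive_cocycles subspace_positive_cocycles]
        B2_subset_positive_cocycles C.subspace_add[OF subspace_positive_cocycles] by blast
  qed
  then show "C.span ?U \<subseteq> positive_cocycles"
    by (rule C.span_minimal) (rule subspace_positive_cocycles)
next
  have U: "\<phi> + \<beta> \<in> ?U" if "\<phi> \<in> C.span (weight_cocycles sL brL grL 2)" "\<beta> \<in> B2L" for \<phi> \<beta>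
    using that by (auto simp: H2_weight_def H2_class_def elt_set_plus_def intro!: bexI[of _ 2])
  have U0: "\<phi> \<in> ?U" if "\<phi> \<in> weight_cocycles sL brL grL 2" for \<phi>
    using U[OF C.span_base[OF that] C.subspace_0[OF subspace_B2]] by simp
  have U1: "\<beta> \<in> ?U" if "\<beta> \<in> B2L" for \<beta>
    using U[OF C.span_zero that] by simp
  show "positive_cocycles \<subseteq> C.span ?U"
  proof
    fix \<phi> assume "\<phi> \<in> positive_cocycles"
    then obtain v u \<xi> \<beta> where
      v: "v \<in> constants D" and xi: "\<xi> \<in> Xi sc D" and b: "\<beta> \<in> B2L" and phi: "\<phi> = basic v u \<xi> + \<beta>"
      unfolding positive_cocycles_def by blast
    have "cocycle_i v \<in> C.span ?U" "cocycle_ii sc u \<in> C.span ?U" "cocycle_iii sc D \<xi> \<in> C.span ?U"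
      using cocycle_i_Z2[OF v] cocycle_ii_Z2[of u] cocycle_iii_Z2[OF xi]
        basic_weight_two(1)[OF v] basic_weight_two(2)[of u] basic_weight_two(3)[OF xi]
      by (intro C.span_base U0; simp add: weight_cocycles_def)+
    then show "\<phi> \<in> C.span ?U"
      unfolding phi basic_def using C.span_base[OF U1[OF b]] by (intro C.span_add)
  qed
qed

lemma H2_plus_eq:
  "H2_plus sL brL grL = {H2_class sL brL (basic v u \<xi>) | v u \<xi>. v \<in> constants D \<and> \<xi> \<in> Xi sc D}"
proof -
  have "H2_class sL brL (\<phi> + \<beta>) = H2_class sL brL \<phi>" if "\<beta> \<in> B2L" for \<phi> \<beta>
    unfolding H2_class_def C.coset_eq_iff[OF subspace_B2] using that by simp
  then show ?thesis
    unfolding H2_plus_def span_weight_cocycles positive_cocycles_def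
    using C.subspace_0[OF subspace_B2] by (fastforce simp: image_iff)
qed

text \<open>By \<open>class_map_coset\<close> all members of the union coincide; taking the union avoids choosing a
  representative of the coset \<open>X\<close>.\<close>

definition class_map :: "'a \<times> 'a set \<times> ('a \<Rightarrow> 'k) \<Rightarrow> (('k, 'a) SAD \<Rightarrow> ('k, 'a) SAD \<Rightarrow> ('k, 'a) SAD) set"
  where "class_map = (\<lambda>(v, X, \<xi>). \<Union>u\<in>X. H2_class sL brL (basic v u \<xi>))"

lemma class_map_coset: "class_map (v, u +o range D, \<xi>) = H2_class sL brL (basic v u \<xi>)"
proof -
  have "H2_class sL brL (basic v (u + D z) \<xi>) = H2_class sL brL (basic v u \<xi>)" for z
  proof -
    have "basic v (u + D z) \<xi> = basic v u \<xi> + cocycle_ii sc (D z)"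
      using basic_add[of v 0 u "D z" \<xi> 0] by (simp add: basic_single)
    then show ?thesis
      unfolding H2_class_def C.coset_eq_iff[OF subspace_B2]
      by (simp add: cocycle_ii_coboundary)
  qed
  then show ?thesis by (auto simp: class_map_def elt_set_plus_def)
qed

lemma basic_class_eqD:
  assumes "\<xi> \<in> Xi sc D" "\<xi>' \<in> Xi sc D"
    and eq: "H2_class sL brL (basic v u \<xi>) = H2_class sL brL (basic v' u' \<xi>')"
  shows "v = v'" "u +o range D = u' +o range D" "\<xi> = \<xi>'"
proof -
  have "- \<xi>' = (\<lambda>a. (- 1) * \<xi>' a)" by auto
  then have neg: "- \<xi>' \<in> Xi sc D" using Xi_closed(3)[OF assms(2), of "- 1"] by simp
  have xi: "\<xi> - \<xi>' \<in> Xi sc D" using Xi_closed(2)[OF assms(1) neg] by simp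
  have "basic (v - v') (u - u') (\<xi> - \<xi>') = basic v u \<xi> - basic v' u' \<xi>'"
    using basic_add[of "v - v'" v' "u - u'" u' "\<xi> - \<xi>'" \<xi>'] by (simp add: algebra_simps)
  then have "basic (v - v') (u - u') (\<xi> - \<xi>') \<in> B2L"
    using eq unfolding H2_class_def C.coset_eq_iff[OF subspace_B2] by simp
  from basic_coboundaryD[OF xi this] show "v = v'" "u +o range D = u' +o range D" "\<xi> = \<xi>'"
    by (simp_all add: coset_eq_iff[OF subspace_range_D])
qed

lemma linear_iso_class_map:
  "linear_iso (summand_scale sc D) (constants D \<times> quot UNIV (range D) \<times> Xi sc D)
    (coset_scale (cochain_scale sL) B2L) (H2_plus sL brL grL) class_map"
proof -
  let ?V = "constants D \<times> quot UNIV (range D) \<times> Xi sc D"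
  have cases: "\<exists>v u \<xi>. x = (v, u +o range D, \<xi>) \<and> v \<in> constants D \<and> \<xi> \<in> Xi sc D" if "x \<in> ?V" for x
    using that unfolding quot_def by blast
  have "inj_on class_map ?V"
  proof (rule inj_onI)
    fix x y assume "x \<in> ?V" "y \<in> ?V" and eq: "class_map x = class_map y"
    then obtain v u \<xi> v' u' \<xi>' where
      x: "x = (v, u +o range D, \<xi>)" "\<xi> \<in> Xi sc D" and y: "y = (v', u' +o range D, \<xi>')" "\<xi>' \<in> Xi sc D"
      using cases by metis
    from basic_class_eqD[OF x(2) y(2)] eq show "x = y"
      unfolding x(1) y(1) class_map_coset by blast
  qed
  moreover have "class_map ` ?V = H2_plus sL brL grL"
    unfolding H2_plus_eq class_map_coset[symmetric] quot_def by blast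
  ultimately have bij: "bij_betw class_map ?V (H2_plus sL brL grL)"
    by (rule bij_betw_imageI)
  have add: "class_map ((v, u +o range D, \<xi>) + (v', u' +o range D, \<xi>')) =
      class_map (v, u +o range D, \<xi>) + class_map (v', u' +o range D, \<xi>')" for v u \<xi> v' u' \<xi>'
    by (simp add: coset_add[OF subspace_range_D] class_map_coset H2_class_def basic_add
        C.coset_add[OF subspace_B2])
  have scale: "class_map (summand_scale sc D c (v, u +o range D, \<xi>)) =
      coset_scale (cochain_scale sL) B2L c (class_map (v, u +o range D, \<xi>))" for c v u \<xi>
    by (simp add: coset_scale_coset[OF subspace_range_D] class_map_coset H2_class_def basic_scale
        C.coset_scale_coset[OF subspace_B2])
  show ?thesis
    unfolding linear_iso_def using bij add scale cases by metis
qed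

end

theorem proposition4p2:
  fixes sc :: "'k::field \<Rightarrow> 'a::comm_ring_1 \<Rightarrow> 'a" and D :: "'a \<Rightarrow> 'a"
  assumes "CHAR('k) = 2"
    and "comm_algebra sc"
    and "derivation sc D"
    and "\<exists>a. D a \<noteq> 0"
  shows
    "(\<forall>v\<in>constants D. cocycle_i v \<in> Z2 (SAD_scale sc) (SAD_br sc D)) \<and>
     (\<forall>v. cocycle_ii sc v \<in> Z2 (SAD_scale sc) (SAD_br sc D)) \<and>
     (\<forall>\<xi>\<in>Xi sc D. cocycle_iii sc D \<xi> \<in> Z2 (SAD_scale sc) (SAD_br sc D)) \<and>
     (\<exists>\<Phi>.
        linear_iso
          (summand_scale sc D)
          (constants D \<times> quot UNIV (range D) \<times> Xi sc D)
          (coset_scale (cochain_scale (SAD_scale sc)) (B2 (SAD_scale sc) (SAD_br sc D)))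
          (H2_plus (SAD_scale sc) (SAD_br sc D) SAD_grading)
          \<Phi> \<and>
        (\<forall>v\<in>constants D.
           \<Phi> (v, range D, 0) = H2_class (SAD_scale sc) (SAD_br sc D) (cocycle_i v)) \<and>
        (\<forall>v.
           \<Phi> (0, v +o range D, 0) = H2_class (SAD_scale sc) (SAD_br sc D) (cocycle_ii sc v)) \<and>
        (\<forall>\<xi>\<in>Xi sc D.
           \<Phi> (0, range D, \<xi>) = H2_class (SAD_scale sc) (SAD_br sc D) (cocycle_iii sc D \<xi>)))"
proof -
  interpret derivation_algebra_char2 sc D
    using assms by unfold_locales
  have coset0: "0 +o range D = range D" by (simp add: elt_set_plus_def)
  have class_values: "class_map (v, range D, 0) = H2_class sL brL (cocycle_i v)"
    "class_map (0, v +o range D, 0) = H2_class sL brL (cocycle_ii sc v)"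
    "class_map (0, range D, \<xi>) = H2_class sL brL (cocycle_iii sc D \<xi>)" for v \<xi>
    using class_map_coset[of v 0 0] class_map_coset[of 0 v 0] class_map_coset[of 0 0 \<xi>]
    by (simp_all only: basic_single coset0)
  show ?thesis
  proof (intro conjI ballI allI)
    show "\<exists>\<Phi>. linear_iso (summand_scale sc D) (constants D \<times> quot UNIV (range D) \<times> Xi sc D)
        (coset_scale (cochain_scale sL) B2L) (H2_plus sL brL grL) \<Phi> \<and>
      (\<forall>v\<in>constants D. \<Phi> (v, range D, 0) = H2_class sL brL (cocycle_i v)) \<and>
      (\<forall>v. \<Phi> (0, v +o range D, 0) = H2_class sL brL (cocycle_ii sc v)) \<and>
      (\<forall>\<xi>\<in>Xi sc D. \<Phi> (0, range D, \<xi>) = H2_class sL brL (cocycle_iii sc D \<xi>))"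
      by (rule exI[of _ class_map]) (intro conjI ballI allI linear_iso_class_map class_values)
  qed (rule cocycle_i_Z2 cocycle_ii_Z2 cocycle_iii_Z2, assumption?)+
qed

end
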